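(* Every weakly l.f.g.u. strongly positive monoid $\mathcal H = (H, \preceq)$ is FF-atomic.
   Context: A premonoid is a pair $\mathcal H = (H, \preceq)$ consisting of a (multiplicatively written) monoid $H$ with identity $1_H$ and a preorder (reflexive, transitive relation) $\preceq$ on $H$. Write $x \prec y$ if $x \preceq y$ and $y \not\preceq x$. An element $u \in H$ is a $\preceq$-unit if $u \preceq 1_H \preceq u$ and a $\preceq$-non-unit otherwise; $\mathcal H^\times$ is the set of $\preceq$-units. A $\preceq$-atom is a $\preceq$-non-unit that is not a product of two $\preceq$-non-units; $\mathscr A(\mathcal H)$ is the set of $\preceq$-atoms. $\mathcal H$ is a strongly positive monoid if, for all $x, y, u, v \in H$: $x \preceq y$ implies $uxv \preceq uyv$; $x \prec y$ implies $uxv \prec uyv$; and $1_H \preceq x$. A subpremonoid of $\mathcal H$ is a premonoid $(K,\preceq_K)$ with $K$ a submonoid of $H$ and $\preceq_K$ the restriction of $\preceq$ to $K$. A divisor of $x$ in $H$ is an element $y \in H$ with $x \in HyH$. The germ of $\mathcal H$ at $x \in H$ is the subpremonoid of $\mathcal H$ whose underlying monoid is the submonoid of $H$ generated by all divisors of $x$ in $H$. A premonoid $\mathcal K = (K, \preceq_K)$ is f.g.u. if $K$ is generated as a monoid by $\mathcal K^\times A\, \mathcal K^\times$ for some finite $A \subseteq K$, where $\mathcal K^\times$ is the set of $\preceq_K$-units. $\mathcal H$ is weakly l.f.g.u. if its germ at every $\preceq$-non-unit is f.g.u. For a set $X$, $\mathscr F(X)$ is the free monoid on $X$, whose elements ($X$-words)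 are the finite tuples of elements of $X$; $\|\mathfrak a\|$ is the length of $\mathfrak a$ and $\mathfrak a[i]$ its $i$-th letter. Define a preorder on $\mathscr F(H)$ by: $\mathfrak a \sqsubseteq_{\mathcal H} \mathfrak b$ iff there is an injective $\sigma \colon \{1, \ldots, \|\mathfrak a\|\} \to \{1, \ldots, \|\mathfrak b\|\}$ with $\mathfrak a[i] \preceq \mathfrak b[\sigma(i)] \preceq \mathfrak a[i]$ for every $i$. Words are $\sqsubseteq_{\mathcal H}$-equivalent if each is $\sqsubseteq_{\mathcal H}$ the other. An atomic $\preceq$-factorization of $x \in H$ is an $\mathscr A(\mathcal H)$-word whose letters multiply (in order) to $x$. $\mathcal H$ is FF-atomic if, for every $\preceq$-non-unit $x$, the set of atomic $\preceq$-factorizations of $x$ is non-empty and has finitely many classes under $\sqsubseteq_{\mathcal H}$-equivalence. *)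

theory Defs
  imports "HOL-Algebra.Coset"
begin

(* As with the other operations of a HOL-Algebra record, the values of the preorder outside
   the carrier are irrelevant; shrinking the carrier thus restricts the preorder. *)
record 'a premonoid = "'a monoid" +
  pre_le :: "'a \<Rightarrow> 'a \<Rightarrow> bool"  (infixl \<open>\<preceq>\<index>\<close> 50)

locale premonoid = monoid H for H :: "('a, 'b) premonoid_scheme" (structure) +
  assumes pre_refl: "reflp_on (carrier H) (pre_le H)"
    and pre_trans: "transp_on (carrier H) (pre_le H)"

definition pre_less :: "('a, 'b) premonoid_scheme \<Rightarrow> 'a \<Rightarrow> 'a \<Rightarrow> bool"  (infixl \<open>\<prec>\<index>\<close> 50)
  where "x \<prec>\<^bsub>H\<^esub> y \<longleftrightarrow> x \<preceq>\<^bsub>H\<^esub> y \<and> \<not> y \<preceq>\<^bsub>H\<^esub> x"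

definition pre_units :: "('a, 'b) premonoid_scheme \<Rightarrow> 'a set"
  where "pre_units H = {u \<in> carrier H. u \<preceq>\<^bsub>H\<^esub> \<one>\<^bsub>H\<^esub> \<and> \<one>\<^bsub>H\<^esub> \<preceq>\<^bsub>H\<^esub> u}"

definition pre_nonunits :: "('a, 'b) premonoid_scheme \<Rightarrow> 'a set"
  where "pre_nonunits H = carrier H - pre_units H"

definition pre_atoms :: "('a, 'b) premonoid_scheme \<Rightarrow> 'a set"
  where "pre_atoms H = {a \<in> pre_nonunits H.
    \<not> (\<exists>x \<in> pre_nonunits H. \<exists>y \<in> pre_nonunits H. a = x \<otimes>\<^bsub>H\<^esub> y)}"

locale strongly_positive_monoid = premonoid H for H (structure) +
  assumes mult_pre_le:
      "\<lbrakk>x \<in> carrier H; y \<in> carrier H; u \<in> carrier H; v \<in> carrier H; x \<preceq> y\<rbrakk>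
        \<Longrightarrow> u \<otimes> x \<otimes> v \<preceq> u \<otimes> y \<otimes> v"
    and mult_pre_less:
      "\<lbrakk>x \<in> carrier H; y \<in> carrier H; u \<in> carrier H; v \<in> carrier H; x \<prec> y\<rbrakk>
        \<Longrightarrow> u \<otimes> x \<otimes> v \<prec> u \<otimes> y \<otimes> v"
    and one_pre_le: "x \<in> carrier H \<Longrightarrow> \<one> \<preceq> x"

definition submonoid_gen :: "('a, 'b) monoid_scheme \<Rightarrow> 'a set \<Rightarrow> 'a set"
  where "submonoid_gen G S = \<Inter>{K. submonoid K G \<and> S \<subseteq> K}"

(* Two-sided divisors, x \<in> HyH; this is not HOL-Algebra's one-sided factor relation. *)
definition divisors :: "('a, 'b) monoid_scheme \<Rightarrow> 'a \<Rightarrow> 'a set"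
  where "divisors G x =
    {y \<in> carrier G. \<exists>u \<in> carrier G. \<exists>v \<in> carrier G. x = u \<otimes>\<^bsub>G\<^esub> y \<otimes>\<^bsub>G\<^esub> v}"

definition germ :: "('a, 'b) premonoid_scheme \<Rightarrow> 'a \<Rightarrow> ('a, 'b) premonoid_scheme"
  where "germ H x = H\<lparr>carrier := submonoid_gen H (divisors H x)\<rparr>"

lemma (in monoid) submonoid_submonoid_gen:
  assumes "S \<subseteq> carrier G"
  shows "submonoid (submonoid_gen G S) G"
proof -
  have "submonoid (carrier G) G"
    by unfold_locales auto
  then have "submonoid_gen G S \<subseteq> carrier G"
    using assms by (auto simp: submonoid_gen_def)
  then show ?thesis
    by (auto simp: submonoid_gen_def submonoid_def)
qed

lemma (in premonoid) premonoid_germ: "premonoid (germ H x)"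
proof -
  have "submonoid (submonoid_gen H (divisors H x)) H"
    by (rule submonoid_submonoid_gen) (auto simp: divisors_def)
  then interpret K: submonoid "submonoid_gen H (divisors H x)" H .
  have "monoid (germ H x)"
    unfolding germ_def by (rule monoidI) (auto intro: K.mem_carrier m_assoc)
  moreover have "reflp_on (carrier (germ H x)) (pre_le (germ H x))"
    using reflp_on_subset[OF pre_refl K.subset] by (simp add: germ_def)
  moreover have "transp_on (carrier (germ H x)) (pre_le (germ H x))"
    using transp_on_subset[OF pre_trans K.subset] by (simp add: germ_def)
  ultimately show ?thesis
    by (simp add: premonoid_def premonoid_axioms_def)
qed

definition fgu :: "('a, 'b) premonoid_scheme \<Rightarrow> bool"
  where "fgu K \<longleftrightarrow> (\<exists>A. finite A \<and> A \<subseteq> carrier K \<and>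
    submonoid_gen K (pre_units K <#>\<^bsub>K\<^esub> A <#>\<^bsub>K\<^esub> pre_units K) = carrier K)"

definition weakly_lfgu :: "('a, 'b) premonoid_scheme \<Rightarrow> bool"
  where "weakly_lfgu H \<longleftrightarrow> (\<forall>x \<in> pre_nonunits H. fgu (germ H x))"

(* Words are lists, with letters indexed from 0. *)
definition word_le :: "('a, 'b) premonoid_scheme \<Rightarrow> 'a list \<Rightarrow> 'a list \<Rightarrow> bool"
  where "word_le H a b \<longleftrightarrow>
    (\<exists>\<sigma>. inj_on \<sigma> {..<length a} \<and> \<sigma> \<in> {..<length a} \<rightarrow> {..<length b} \<and>
      (\<forall>i < length a. a ! i \<preceq>\<^bsub>H\<^esub> b ! \<sigma> i \<and> b ! \<sigma> i \<preceq>\<^bsub>H\<^esub> a ! i))"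

definition word_equiv :: "('a, 'b) premonoid_scheme \<Rightarrow> ('a list \<times> 'a list) set"
  where "word_equiv H =
    {(a, b) \<in> lists (carrier H) \<times> lists (carrier H). word_le H a b \<and> word_le H b a}"

definition atomic_factorizations :: "('a, 'b) premonoid_scheme \<Rightarrow> 'a \<Rightarrow> 'a list set"
  where "atomic_factorizations H x =
    {a \<in> lists (pre_atoms H). foldr (\<otimes>\<^bsub>H\<^esub>) a \<one>\<^bsub>H\<^esub> = x}"

definition FF_atomic :: "('a, 'b) premonoid_scheme \<Rightarrow> bool"
  where "FF_atomic H \<longleftrightarrow> (\<forall>x \<in> pre_nonunits H.
    atomic_factorizations H x \<noteq> {} \<and> finite (atomic_factorizations H x // word_equiv H))"

end

theory Submission
  imports Defs "HOL-Library.Sublist" "HOL-Library.Infinite_Set"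
begin

text \<open>
  In a strongly positive monoid, multiplying by a non-unit strictly increases an element. So if a
  word of non-units is a proper scattered subword of another, its product is strictly smaller.
  By Higman's lemma, only finitely many words over a finite set of non-units have a product
  equivalent to a given element. If \<open>UAU\<close> generates the germ at \<open>x\<close>, every factorization of \<open>x\<close>
  into non-units can be refined, up to equivalence, to a word over the non-units of \<open>A\<close>. This
  bounds the lengths of such factorizations, and one of maximal length is atomic. As every atom
  in the germ is equivalent to an element of \<open>A\<close>, the finiteness of the set of words over \<open>A\<close>
  also bounds the number of classes of atomic factorizations.
\<close>

section \<open>Higman's lemma over a finite alphabet\<close>

text \<open>Bad sequences in the sense of Nash-Williams, for the scattered-subword order with
  equality of letters.\<close>

definition subseq_bad :: "'a set \<Rightarrow> (nat \<Rightarrow> 'a list) \<Rightarrow> bool"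
  where "subseq_bad A f \<longleftrightarrow> (\<forall>i. f i \<in> lists A) \<and> (\<forall>i j. i < j \<longrightarrow> \<not> subseq (f i) (f j))"

text \<open>The entries are fixed one after another, each as short as possible among the bad
  sequences that continue the choices made so far.\<close>

lemma minimal_bad_sequence:
  assumes "subseq_bad A f"
  obtains g where "subseq_bad A g"
    and "\<And>h n. \<lbrakk>subseq_bad A h; \<And>i. i < n \<Longrightarrow> h i = g i\<rbrakk> \<Longrightarrow> length (g n) \<le> length (h n)"
proof -
  \<comment> \<open>A stage \<open>F n\<close> is a whole bad sequence of which only the entries
    before \<open>n\<close> are final. The next stage keeps these and minimizes the length of entry
    \<open>n\<close>.\<close>
  define cand where "cand n F h \<longleftrightarrow> subseq_bad A h \<and> (\<forall>i<n. h i = F i)"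
    for n :: nat and F h :: "nat \<Rightarrow> 'a list"
  define nxt where "nxt n F = (ARG_MIN (\<lambda>h. length (h n)) h. cand n F h)"
    for n :: nat and F :: "nat \<Rightarrow> 'a list"
  define F where "F = rec_nat f nxt"
  have nxt_cand: "cand n G (nxt n G)" if "subseq_bad A G" for n G
    unfolding nxt_def by (rule arg_min_natI[where k = G]) (use that in \<open>simp add: cand_def\<close>)
  have nxt_min: "length (nxt n G n) \<le> length (h n)" if "cand n G h" for n G h
    using arg_min_nat_le[of "cand n G" h "\<lambda>h. length (h n)"] that by (simp add: nxt_def)
  have bad_F: "subseq_bad A (F n)" for n
    by (induction n) (use assms nxt_cand in \<open>auto simp: F_def cand_def\<close>)
  have F_Suc: "F (Suc n) = nxt n (F n)" for n
    by (simp add: F_def)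
  have step: "F (Suc n) i = F n i" if "i < n" for n i
    using nxt_cand[OF bad_F, of n n] that by (auto simp: F_Suc cand_def)
  have stable: "F n i = F (Suc i) i" if "i < n" for n i
    using that by (induction n) (auto simp: less_Suc_eq step)
  \<comment> \<open>The diagonal collects each entry at the stage that makes it final.\<close>
  define g where "g n = F (Suc n) n" for n
  have F_g: "F n i = g i" if "i < n" for n i
    using stable[OF that] by (simp add: g_def)
  show thesis
  proof
    have "g i \<in> lists A" for i
      using bad_F[of "Suc i"] unfolding g_def subseq_bad_def by blast
    \<comment> \<open>Both entries already occur in the single bad sequence
      \<open>F (Suc j)\<close>.\<close>
    moreover have "\<not> subseq (g i) (g j)" if "i < j" for i j
      using bad_F[of "Suc j"] F_g[of i "Suc j"] F_g[of j "Suc j"] that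
      unfolding subseq_bad_def by (metis less_SucI lessI)
    ultimately show "subseq_bad A g"
      unfolding subseq_bad_def by blast
  next
    fix h n assume "subseq_bad A h" "\<And>i. i < n \<Longrightarrow> h i = g i"
    then have "cand n (F n) h"
      by (simp add: cand_def F_g)
    then show "length (g n) \<le> length (h n)"
      using nxt_min by (simp add: g_def F_Suc)
  qed
qed

text \<open>Infinitely many words of a minimal bad sequence share their first letter. Removing this
  letter from them gives a bad sequence that contradicts minimality.\<close>

lemma higman_finite_alphabet:
  assumes "finite A"
  shows "\<not> subseq_bad A f"
proof
  assume "subseq_bad A f"
  then obtain g where bad: "subseq_bad A g"
    and min: "\<And>h n. \<lbrakk>subseq_bad A h; \<And>i. i < n \<Longrightarrow> h i = g i\<rbrakk> \<Longrightarrow> length (g n) \<le> length (h n)"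
    by (rule minimal_bad_sequence) blast
  have g_lists: "g n \<in> lists A" and g_bad: "i < j \<Longrightarrow> \<not> subseq (g i) (g j)" for n i j
    using bad by (auto simp: subseq_bad_def)
  have g_ne: "g n \<noteq> []" for n
    using g_bad[of n "Suc n"] by auto
  have "hd (g n) \<in> A" for n
    using g_lists[of n] g_ne[of n] by (cases "g n") auto
  then have "finite (range (\<lambda>n. hd (g n)))"
    by (intro finite_subset[OF _ assms]) auto
  then obtain m where "infinite {n. hd (g n) = hd (g m)}"
    using pigeonhole_infinite[of UNIV "\<lambda>n. hd (g n)"] by auto
  then obtain \<phi> :: "nat \<Rightarrow> nat" where mono: "strict_mono \<phi>"
    and "\<And>k. \<phi> k \<in> {n. hd (g n) = hd (g m)}"
    using infinite_enumerate by metis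
  then have g_\<phi>: "g (\<phi> k) = hd (g m) # tl (g (\<phi> k))" for k
    using g_ne[of "\<phi> k"] by (metis (mono_tags) list.collapse mem_Collect_eq)
  define n where "n = \<phi> 0"
  \<comment> \<open>Everything from the first word of the chosen subsequence on is replaced by the
    tails of that subsequence.\<close>
  define h where "h i = (if i < n then g i else tl (g (\<phi> (i - n))))" for i
  have n_le: "n \<le> \<phi> k" for k
    using strict_mono_less_eq[OF mono] by (simp add: n_def)
  have "h i \<in> lists A" for i
    using g_lists g_\<phi> by (auto simp: h_def) (metis in_listsD list.set_intros(2))
  moreover have "\<not> subseq (h i) (h j)" if "i < j" for i j
  proof
    assume sub: "subseq (h i) (h j)"
    consider "j < n" | "i < n" "n \<le> j" | "n \<le> i"
      using that by linarith
    then show False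
    proof cases
      case 1
      then show ?thesis using sub g_bad[OF that] that by (simp add: h_def)
    next
      case 2
      then have "subseq (g i) (tl (g (\<phi> (j - n))))"
        using sub by (simp add: h_def)
      \<comment> \<open>A subword of a tail is a subword of the whole word, and \<open>n_le\<close>
        puts \<open>i\<close> before \<open>\<phi> (j - n)\<close>.\<close>
      then have "subseq (g i) (g (\<phi> (j - n)))"
        using g_\<phi>[of "j - n"] by (metis list_emb_Cons)
      then show ?thesis
        using g_bad[of i "\<phi> (j - n)"] n_le[of "j - n"] 2 by linarith
    next
      case 3
      then have "subseq (tl (g (\<phi> (i - n)))) (tl (g (\<phi> (j - n))))"
        using sub that by (simp add: h_def)
      \<comment> \<open>The shared first letter can be put back on both sides.\<close>
      then have "subseq (g (\<phi> (i - n))) (g (\<phi> (j - n)))"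
        using g_\<phi>[of "i - n"] g_\<phi>[of "j - n"] by (metis subseq_Cons2)
      moreover have "\<phi> (i - n) < \<phi> (j - n)"
        using strict_monoD[OF mono] 3 that by simp
      ultimately show ?thesis
        using g_bad by blast
    qed
  qed
  ultimately have "subseq_bad A h"
    by (simp add: subseq_bad_def)
  then have "length (g n) \<le> length (h n)"
    by (rule min) (simp add: h_def)
  \<comment> \<open>At index \<open>n\<close>, which is \<open>\<phi> 0\<close>, the sequence
    \<open>h\<close> takes the tail of \<open>g n\<close> itself.\<close>
  moreover have "length (g n) = Suc (length (h n))"
    using g_\<phi>[of 0] by (metis diff_self_eq_0 h_def length_Cons less_irrefl n_def)
  ultimately show False
    by simp
qed

text \<open>An injective enumeration of an infinite antichain would be a bad sequence.\<close>

lemma finite_subseq_antichain: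
  assumes "finite A" "L \<subseteq> lists A" "\<And>v w. \<lbrakk>v \<in> L; w \<in> L; subseq v w\<rbrakk> \<Longrightarrow> v = w"
  shows "finite L"
proof (rule ccontr)
  assume "infinite L"
  then obtain f :: "nat \<Rightarrow> 'a list" where "inj f" "range f \<subseteq> L"
    using infinite_countable_subset by blast
  then have "subseq_bad A f"
    using assms(2,3) unfolding subseq_bad_def
    by (metis inj_eq nat_neq_iff range_subsetD subsetD)
  then show False
    using higman_finite_alphabet[OF assms(1)] by blast
qed

text \<open>On \<open>X\<close> the class of an element depends only on its value under
  \<open>f\<close>, so one preimage for each value yields every class.\<close>

lemma finite_quotient_if_factors:
  assumes "finite (f ` X)" "\<And>a b. \<lbrakk>a \<in> X; b \<in> X; f a = f b\<rbrakk> \<Longrightarrow> r `` {a} = r `` {b}"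
  shows "finite (X // r)"
proof -
  have "X // r \<subseteq> (\<lambda>y. r `` {inv_into X f y}) ` f ` X"
  proof
    fix c assume "c \<in> X // r"
    then obtain a where a: "a \<in> X" "c = r `` {a}"
      by (auto elim: quotientE)
    then have "c = r `` {inv_into X f (f a)}"
      using assms(2)[of a "inv_into X f (f a)"] by (simp add: inv_into_into f_inv_into_f)
    then show "c \<in> (\<lambda>y. r `` {inv_into X f y}) ` f ` X"
      using a by blast
  qed
  then show ?thesis
    using assms(1) finite_surj finite_imageI finite_subset by metis
qed

section \<open>Words in a premonoid\<close>

abbreviation word_prod :: "('a, 'b) monoid_scheme \<Rightarrow> 'a list \<Rightarrow> 'a" (\<open>\<Pi>\<index>\<close>)
  where "word_prod G w \<equiv> foldr (\<otimes>\<^bsub>G\<^esub>) w \<one>\<^bsub>G\<^esub>"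

definition pre_equiv :: "('a, 'b) premonoid_scheme \<Rightarrow> 'a \<Rightarrow> 'a \<Rightarrow> bool"  (infixl \<open>\<approx>\<index>\<close> 50)
  where "x \<approx>\<^bsub>H\<^esub> y \<longleftrightarrow> x \<preceq>\<^bsub>H\<^esub> y \<and> y \<preceq>\<^bsub>H\<^esub> x"

lemma (in monoid) word_prod_closed [simp, intro]:
  "w \<in> lists (carrier G) \<Longrightarrow> \<Pi> w \<in> carrier G"
  by (induction w) auto

text \<open>The product is an abbreviation for a fold, so \<open>foldr_append\<close> would rewrite
  the left-hand side. It is therefore removed from the simpset here and wherever this rule is
  used.\<close>

lemma (in monoid) word_prod_append:
  "\<lbrakk>v \<in> lists (carrier G); w \<in> lists (carrier G)\<rbrakk> \<Longrightarrow> \<Pi> (v @ w) = \<Pi> v \<otimes> \<Pi> w"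
  by (induction v) (auto simp: m_assoc simp del: foldr_append)

context premonoid
begin

lemma le_refl [simp]: "x \<in> carrier H \<Longrightarrow> x \<preceq> x"
  using pre_refl by (rule reflp_onD)

lemma le_trans:
  "\<lbrakk>x \<preceq> y; y \<preceq> z; x \<in> carrier H; y \<in> carrier H; z \<in> carrier H\<rbrakk> \<Longrightarrow> x \<preceq> z"
  using transp_onD[OF pre_trans, of x y z] by simp

lemma pre_equiv_refl [simp]: "x \<in> carrier H \<Longrightarrow> x \<approx> x"
  by (simp add: pre_equiv_def)

lemma pre_equiv_sym: "x \<approx> y \<Longrightarrow> y \<approx> x"
  by (simp add: pre_equiv_def)

lemma pre_equiv_trans:
  "\<lbrakk>x \<approx> y; y \<approx> z; x \<in> carrier H; y \<in> carrier H; z \<in> carrier H\<rbrakk> \<Longrightarrow> x \<approx> z"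
  using le_trans[of x y z] le_trans[of z y x] by (simp add: pre_equiv_def)

lemma pre_less_le_trans:
  "\<lbrakk>x \<prec> y; y \<preceq> z; x \<in> carrier H; y \<in> carrier H; z \<in> carrier H\<rbrakk> \<Longrightarrow> x \<prec> z"
  using le_trans[of x y z] le_trans[of y z x] by (auto simp: pre_less_def)

lemma pre_nonunits_closed: "x \<in> pre_nonunits H \<Longrightarrow> x \<in> carrier H"
  by (simp add: pre_nonunits_def)

lemma pre_units_closed: "x \<in> pre_units H \<Longrightarrow> x \<in> carrier H"
  by (simp add: pre_units_def)

lemma pre_nonunits_lists: "w \<in> lists (pre_nonunits H) \<Longrightarrow> w \<in> lists (carrier H)"
  by (auto simp: pre_nonunits_closed)

lemma pre_units_iff_equiv: "x \<in> pre_units H \<longleftrightarrow> x \<in> carrier H \<and> x \<approx> \<one>"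
  by (auto simp: pre_units_def pre_equiv_def)

lemma word_le_iff:
  "word_le H a b \<longleftrightarrow> (\<exists>\<sigma>. inj_on \<sigma> {..<length a} \<and> \<sigma> \<in> {..<length a} \<rightarrow> {..<length b} \<and>
    (\<forall>i < length a. a ! i \<approx> b ! \<sigma> i))"
  by (simp add: word_le_def pre_equiv_def)

lemma word_le_trans:
  assumes "word_le H a b" "word_le H b c"
    and "a \<in> lists (carrier H)" "b \<in> lists (carrier H)" "c \<in> lists (carrier H)"
  shows "word_le H a c"
proof -
  obtain \<sigma> where \<sigma>: "inj_on \<sigma> {..<length a}" "\<sigma> \<in> {..<length a} \<rightarrow> {..<length b}"
    "\<forall>i < length a. a ! i \<approx> b ! \<sigma> i"
    using assms(1) by (auto simp: word_le_iff)
  obtain \<tau> where \<tau>: "inj_on \<tau> {..<length b}" "\<tau> \<in> {..<length b} \<rightarrow> {..<length c}"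
    "\<forall>i < length b. b ! i \<approx> c ! \<tau> i"
    using assms(2) by (auto simp: word_le_iff)
  have "inj_on (\<tau> \<circ> \<sigma>) {..<length a}"
    using \<sigma>(1,2) \<tau>(1) by (auto intro!: comp_inj_on intro: inj_on_subset)
  moreover have "\<tau> \<circ> \<sigma> \<in> {..<length a} \<rightarrow> {..<length c}"
    using \<sigma>(2) \<tau>(2) by auto
  moreover have "a ! i \<approx> c ! (\<tau> \<circ> \<sigma>) i" if "i < length a" for i
  proof -
    have "\<sigma> i < length b"
      using \<sigma>(2) that by auto
    moreover from this have "\<tau> (\<sigma> i) < length c"
      using \<tau>(2) by auto
    ultimately show ?thesis
      using \<sigma>(3) \<tau>(3) that assms(3-5)
        pre_equiv_trans[of "a ! i" "b ! \<sigma> i" "c ! \<tau> (\<sigma> i)"]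
      by (simp add: lists_eq_set subset_eq)
  qed
  ultimately show ?thesis
    unfolding word_le_iff by blast
qed

lemma word_le_if_letters_equiv:
  assumes "list_all2 (pre_equiv H) a b"
  shows "word_le H a b"
  unfolding word_le_iff
  using assms by (intro exI[of _ id]) (auto simp: list_all2_conv_all_nth)

lemma equiv_word_equiv: "equiv (lists (carrier H)) (word_equiv H)"
proof (rule equivI)
  show "refl_on (lists (carrier H)) (word_equiv H)"
    by (auto simp: refl_on_def word_equiv_def
        intro!: word_le_if_letters_equiv list.rel_refl_strong)
  show "sym (word_equiv H)"
    by (auto simp: sym_def word_equiv_def)
  show "trans (word_equiv H)"
    by (rule transI) (use word_le_trans in \<open>unfold word_equiv_def, blast\<close>)
  show "word_equiv H \<subseteq> lists (carrier H) \<times> lists (carrier H)"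
    by (auto simp: word_equiv_def)
qed

end

section \<open>Strongly positive monoids\<close>

context strongly_positive_monoid
begin

section \<open>Units, non-units and strictness under multiplication\<close>

lemma mult_mono:
  assumes "x \<preceq> x'" "y \<preceq> y'"
    and [simp]: "x \<in> carrier H" "x' \<in> carrier H" "y \<in> carrier H" "y' \<in> carrier H"
  shows "x \<otimes> y \<preceq> x' \<otimes> y'"
proof (rule le_trans)
  show "x \<otimes> y \<preceq> x' \<otimes> y"
    using mult_pre_le[of x x' \<one> y] assms(1) by simp
  show "x' \<otimes> y \<preceq> x' \<otimes> y'"
    using mult_pre_le[of y y' x' \<one>] assms(2) by simp
qed auto

lemma mult_equiv:
  "\<lbrakk>x \<approx> x'; y \<approx> y'; x \<in> carrier H; x' \<in> carrier H; y \<in> carrier H; y' \<in> carrier H\<rbrakk>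
    \<Longrightarrow> x \<otimes> y \<approx> x' \<otimes> y'"
  unfolding pre_equiv_def by (blast intro: mult_mono)

lemma mult_unit_right_equiv: "\<lbrakk>u \<in> pre_units H; x \<in> carrier H\<rbrakk> \<Longrightarrow> x \<otimes> u \<approx> x"
  using mult_equiv[of x x u \<one>] by (simp add: pre_units_iff_equiv)

lemma mult_unit_left_equiv: "\<lbrakk>u \<in> pre_units H; x \<in> carrier H\<rbrakk> \<Longrightarrow> u \<otimes> x \<approx> x"
  using mult_equiv[of u \<one> x x] by (simp add: pre_units_iff_equiv)

lemma le_mult_right: "\<lbrakk>x \<in> carrier H; y \<in> carrier H\<rbrakk> \<Longrightarrow> x \<preceq> x \<otimes> y"
  using mult_mono[of x x \<one> y] by (simp add: one_pre_le)

lemma le_mult_left: "\<lbrakk>x \<in> carrier H; y \<in> carrier H\<rbrakk> \<Longrightarrow> x \<preceq> y \<otimes> x"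
  using mult_mono[of \<one> y x x] by (simp add: one_pre_le)

text \<open>Positivity gives \<one> \<prec> \<open>a\<close>, and strict monotonicity transports
  this to \<open>x\<close>. Such strictness takes the place of cancellation.\<close>

lemma less_nonunit_mult:
  assumes "a \<in> pre_nonunits H" "x \<in> carrier H"
  shows "x \<prec> a \<otimes> x"
proof -
  have "\<one> \<prec> a"
    using assms(1) one_pre_le by (auto simp: pre_less_def pre_nonunits_def pre_units_def)
  then show ?thesis
    using mult_pre_less[of \<one> a \<one> x] assms by (simp add: pre_nonunits_closed)
qed

text \<open>By positivity the units are exactly the elements below the identity, so they are closed
  downward.\<close>

lemma pre_nonunits_upward:
  assumes "x \<in> pre_nonunits H" "x \<preceq> y" "y \<in> carrier H"
  shows "y \<in> pre_nonunits H"
proof -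
  have "\<not> y \<preceq> \<one>"
    using assms one_pre_le le_trans[of x y \<one>] by (auto simp: pre_nonunits_def pre_units_def)
  then show ?thesis
    using assms(3) by (simp add: pre_nonunits_def pre_units_def)
qed

lemma nonunit_mult_right: "\<lbrakk>x \<in> pre_nonunits H; y \<in> carrier H\<rbrakk> \<Longrightarrow> x \<otimes> y \<in> pre_nonunits H"
  using pre_nonunits_upward[of x "x \<otimes> y"] by (simp add: le_mult_right pre_nonunits_closed)

lemma nonunit_mult_left: "\<lbrakk>x \<in> pre_nonunits H; y \<in> carrier H\<rbrakk> \<Longrightarrow> y \<otimes> x \<in> pre_nonunits H"
  using pre_nonunits_upward[of x "y \<otimes> x"] by (simp add: le_mult_left pre_nonunits_closed)

lemma unit_mult: "\<lbrakk>u \<in> pre_units H; v \<in> pre_units H\<rbrakk> \<Longrightarrow> u \<otimes> v \<in> pre_units H"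
  using mult_equiv[of u \<one> v \<one>] by (simp add: pre_units_iff_equiv)

section \<open>Products along scattered subwords\<close>

text \<open>An inserted letter is a non-unit and makes the product strictly larger; a common letter
  preserves strictness by \<open>mult_pre_less\<close>.\<close>

lemma subseq_word_prod:
  assumes "subseq v w" "w \<in> lists (pre_nonunits H)"
  shows "v \<in> lists (pre_nonunits H) \<and> (v = w \<or> \<Pi> v \<prec> \<Pi> w)"
  using assms
proof (induction rule: list_emb.induct)
  \<comment> \<open>This rule embeds the empty word into an arbitrary \<open>ys\<close>, so a
    nonempty \<open>ys\<close> needs \<one> \<prec> \<open>\<Pi> ys\<close> in one go.\<close>
  case (list_emb_Nil ys)
  show ?case
  proof (cases ys)
    case (Cons b bs)
    then have "\<Pi> bs \<prec> \<Pi> ys"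
      using list_emb_Nil by (auto intro!: less_nonunit_mult simp: pre_nonunits_closed)
    moreover have "\<one> \<preceq> \<Pi> bs"
      using list_emb_Nil Cons by (intro one_pre_le word_prod_closed) (auto simp: pre_nonunits_closed)
    ultimately have "\<one> \<prec> \<Pi> ys"
      using list_emb_Nil Cons le_trans[of "\<Pi> ys" \<one> "\<Pi> bs"] le_trans[of \<one> "\<Pi> bs" "\<Pi> ys"]
        word_prod_closed[of bs] word_prod_closed[of ys]
      by (force simp: pre_less_def pre_nonunits_closed)
    then show ?thesis by simp
  qed simp
next
  case (list_emb_Cons xs ys y)
  then have ys: "y \<in> pre_nonunits H" "\<Pi> ys \<in> carrier H" "\<Pi> xs \<in> carrier H"
    by (auto simp: pre_nonunits_closed intro!: word_prod_closed)
  then have "\<Pi> ys \<prec> y \<otimes> \<Pi> ys"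
    by (intro less_nonunit_mult)
  moreover have "\<Pi> xs \<prec> y \<otimes> \<Pi> ys" if "\<Pi> xs \<prec> \<Pi> ys"
    using pre_less_le_trans[OF that, of "y \<otimes> \<Pi> ys"] le_mult_left[of "\<Pi> ys" y] ys
    by (simp add: pre_nonunits_closed)
  ultimately show ?case
    using list_emb_Cons by auto
next
  case (list_emb_Cons2 x y xs ys)
  then have ys: "y \<in> pre_nonunits H" "\<Pi> ys \<in> carrier H" "\<Pi> xs \<in> carrier H"
    by (auto simp: pre_nonunits_closed intro!: word_prod_closed)
  then have "y \<otimes> \<Pi> xs \<prec> y \<otimes> \<Pi> ys" if "\<Pi> xs \<prec> \<Pi> ys"
    using mult_pre_less[of "\<Pi> xs" "\<Pi> ys" y \<one>] that by (simp add: pre_nonunits_closed)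
  then show ?case
    using list_emb_Cons2 by auto
qed

text \<open>A proper subword would have a strictly smaller product, whereas all these products are
  equivalent to \<open>x\<close>. The words thus form an antichain.\<close>

lemma finite_words_equiv_prod:
  assumes "finite A" "A \<subseteq> pre_nonunits H" "x \<in> carrier H"
  shows "finite {w \<in> lists A. \<Pi> w \<approx> x}" (is "finite ?L")
proof (rule finite_subseq_antichain[OF assms(1)])
  fix v w assume vw: "v \<in> ?L" "w \<in> ?L" "subseq v w"
  then have "v \<in> lists (pre_nonunits H)" "w \<in> lists (pre_nonunits H)"
    using assms(2) by (auto simp: lists_eq_set)
  moreover from this have "\<Pi> w \<preceq> \<Pi> v"
    using vw(1,2) assms(3) pre_nonunits_lists word_prod_closed
    by (auto intro!: le_trans[of "\<Pi> w" x "\<Pi> v"] simp: pre_equiv_def)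
  ultimately show "v = w"
    using subseq_word_prod[OF vw(3)] by (auto simp: pre_less_def)
qed auto

lemma word_prod_equiv:
  assumes "list_all2 (pre_equiv H) v w" "v \<in> lists (carrier H)" "w \<in> lists (carrier H)"
  shows "\<Pi> v \<approx> \<Pi> w"
  using assms by (induction rule: list_all2_induct) (auto intro!: mult_equiv word_prod_closed)

section \<open>Germs and their generators up to equivalence\<close>

lemma germ_submonoid: "submonoid (carrier (germ H x)) H"
  unfolding germ_def by (simp, rule submonoid_submonoid_gen) (auto simp: divisors_def)

lemma divisors_subset_germ: "divisors H x \<subseteq> carrier (germ H x)"
  by (auto simp: germ_def submonoid_gen_def)

text \<open>This places every letter of a factorization of \<open>x\<close> in the germ at
  \<open>x\<close>, where the generators are available.\<close>

lemma letter_in_divisors: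
  assumes "w \<in> lists (carrier H)" "a \<in> set w"
  shows "a \<in> divisors H (\<Pi> w)"
proof -
  obtain u v where w: "w = u @ a # v"
    using assms(2) by (auto dest: split_list)
  then have uv: "u \<in> lists (carrier H)" "v \<in> lists (carrier H)" "a \<in> carrier H"
    using assms(1) by auto
  then have "\<Pi> w = \<Pi> u \<otimes> a \<otimes> \<Pi> v"
    using w word_prod_append[of u "a # v"] by (simp add: m_assoc del: foldr_append)
  then show ?thesis
    using uv by (auto simp: divisors_def)
qed

text \<open>
  Transfers generation inside the germ, whose operations and preorder are those of \<open>H\<close>, to an
  induction principle in \<open>H\<close>.
\<close>
lemma germ_fgu_induct:
  assumes A: "A \<subseteq> carrier (germ H x)"
    and gen: "submonoid_gen (germ H x) (pre_units (germ H x) <#>\<^bsub>germ H x\<^esub> A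
      <#>\<^bsub>germ H x\<^esub> pre_units (germ H x)) = carrier (germ H x)"
    and y: "y \<in> carrier (germ H x)"
    and one: "P \<one>"
    and mult: "\<And>y z. \<lbrakk>y \<in> carrier H; z \<in> carrier H; P y; P z\<rbrakk> \<Longrightarrow> P (y \<otimes> z)"
    and base: "\<And>u a v. \<lbrakk>u \<in> pre_units H; a \<in> A; a \<in> carrier H; v \<in> pre_units H\<rbrakk> \<Longrightarrow> P (u \<otimes> a \<otimes> v)"
  shows "P y"
proof -
  interpret M: submonoid "carrier (germ H x)" H
    by (rule germ_submonoid)
  \<comment> \<open>The elements with property \<open>P\<close> form a submonoid of the germ that
    contains its generators.\<close>
  define K where "K = {y \<in> carrier (germ H x). P y}"
  have germ_simps: "mult (germ H x) = mult H" "one (germ H x) = one H"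
    "pre_le (germ H x) = pre_le H"
    by (simp_all add: germ_def)
  have "submonoid K (germ H x)"
  proof
    show "K \<subseteq> carrier (germ H x)"
      by (auto simp: K_def)
    show "\<one>\<^bsub>germ H x\<^esub> \<in> K"
      using one by (simp add: K_def germ_simps)
    show "y \<otimes>\<^bsub>germ H x\<^esub> z \<in> K" if "y \<in> K" "z \<in> K" for y z
      using that mult[of y z] M.mem_carrier by (simp add: K_def germ_simps)
  qed
  moreover have "pre_units (germ H x) <#>\<^bsub>germ H x\<^esub> A <#>\<^bsub>germ H x\<^esub> pre_units (germ H x) \<subseteq> K"
  proof
    fix z assume "z \<in> pre_units (germ H x) <#>\<^bsub>germ H x\<^esub> A <#>\<^bsub>germ H x\<^esub> pre_units (germ H x)"
    then obtain u a v where z: "z = u \<otimes> a \<otimes> v" "a \<in> A"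
      and u: "u \<in> pre_units (germ H x)" and v: "v \<in> pre_units (germ H x)"
      unfolding set_mult_def germ_simps by blast
    have M: "u \<in> carrier (germ H x)" "a \<in> carrier (germ H x)" "v \<in> carrier (germ H x)"
      using u v z(2) A by (auto simp: pre_units_def)
    then have "u \<in> pre_units H" "v \<in> pre_units H"
      using u v M.mem_carrier by (simp_all add: pre_units_def germ_simps)
    then show "z \<in> K"
      using base z M by (simp add: K_def)
  qed
  ultimately have "carrier (germ H x) \<subseteq> K"
    using gen unfolding submonoid_gen_def by blast
  then show ?thesis
    using y by (auto simp: K_def)
qed

text \<open>Units disappear up to equivalence: a generator \<open>u \<otimes> a \<otimes> v\<close>
  is equivalent to \<open>a\<close>, and to the identity if \<open>a\<close> is a unit. The
  non-units among the given generators therefore suffice.\<close>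

lemma fgu_germ_representatives:
  assumes "fgu (germ H x)"
  obtains A where "finite A" "A \<subseteq> pre_nonunits H"
    and "\<And>y. y \<in> carrier (germ H x) \<Longrightarrow> \<exists>w \<in> lists A. \<Pi> w \<approx> y"
    and "\<And>a. \<lbrakk>a \<in> carrier (germ H x); a \<in> pre_atoms H\<rbrakk> \<Longrightarrow> \<exists>b \<in> A. b \<approx> a"
proof -
  obtain B where B: "finite B" "B \<subseteq> carrier (germ H x)"
    and gen: "submonoid_gen (germ H x) (pre_units (germ H x) <#>\<^bsub>germ H x\<^esub> B
      <#>\<^bsub>germ H x\<^esub> pre_units (germ H x)) = carrier (germ H x)"
    using assms by (auto simp: fgu_def)
  note induct = germ_fgu_induct[OF B(2) gen]
  let ?A = "B \<inter> pre_nonunits H"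
  have lists: "w \<in> lists ?A \<Longrightarrow> w \<in> lists (carrier H)" for w
    by (auto simp: pre_nonunits_closed)
  have gen_equiv: "a \<approx> u \<otimes> a \<otimes> v"
    if "u \<in> pre_units H" "a \<in> carrier H" "v \<in> pre_units H" for u a v
    using that mult_unit_right_equiv[of v "u \<otimes> a"] mult_unit_left_equiv[of u a]
      pre_equiv_trans[of "u \<otimes> a \<otimes> v" "u \<otimes> a" a]
    by (simp add: pre_units_closed pre_equiv_sym)
  have "\<exists>w \<in> lists ?A. \<Pi> w \<approx> y" if "y \<in> carrier (germ H x)" for y
    using that
  proof (rule induct)
    show "\<exists>w \<in> lists ?A. \<Pi> w \<approx> \<one>"
      by (rule bexI[of _ "[]"]) auto
  next
    fix y z assume yz: "y \<in> carrier H" "z \<in> carrier H"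
      and "\<exists>v \<in> lists ?A. \<Pi> v \<approx> y" "\<exists>w \<in> lists ?A. \<Pi> w \<approx> z"
    then obtain v w where v: "v \<in> lists ?A" "\<Pi> v \<approx> y" and w: "w \<in> lists ?A" "\<Pi> w \<approx> z"
      by blast
    then have "\<Pi> (v @ w) \<approx> y \<otimes> z"
      using lists[OF v(1)] lists[OF w(1)] yz
      by (simp add: word_prod_append mult_equiv word_prod_closed del: foldr_append)
    then show "\<exists>w \<in> lists ?A. \<Pi> w \<approx> y \<otimes> z"
      using v(1) w(1) by (metis append_in_lists_conv)
  next
    fix u a v assume a: "u \<in> pre_units H" "a \<in> B" "a \<in> carrier H" "v \<in> pre_units H"
    show "\<exists>w \<in> lists ?A. \<Pi> w \<approx> u \<otimes> a \<otimes> v"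
    proof (cases "a \<in> pre_units H")
      case True
      then have "u \<otimes> a \<otimes> v \<in> pre_units H"
        using a by (simp add: unit_mult)
      then have "\<Pi> [] \<approx> u \<otimes> a \<otimes> v"
        by (simp add: pre_units_iff_equiv pre_equiv_sym)
      then show ?thesis by blast
    next
      case False
      then have "[a] \<in> lists ?A" "\<Pi> [a] \<approx> u \<otimes> a \<otimes> v"
        using a gen_equiv by (auto simp: pre_nonunits_def pre_units_closed)
      then show ?thesis by blast
    qed
  qed
  moreover have "\<exists>b \<in> ?A. b \<approx> a" if "a \<in> carrier (germ H x)" "a \<in> pre_atoms H" for a
  proof -
    \<comment> \<open>Being an atom does not pass to products. The induction uses three alternatives
      that together do; for an atom only the last can hold.\<close>
    define reducible where "reducible y \<longleftrightarrow>
      (\<exists>p \<in> pre_nonunits H. \<exists>q \<in> pre_nonunits H. y = p \<otimes> q)" for y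
    have "a \<in> pre_units H \<or> reducible a \<or> (\<exists>b \<in> ?A. b \<approx> a)"
      using that(1)
    proof (rule induct)
      show "\<one> \<in> pre_units H \<or> reducible \<one> \<or> (\<exists>b \<in> ?A. b \<approx> \<one>)"
        by (simp add: pre_units_iff_equiv)
    next
      fix y z assume y: "y \<in> carrier H" "y \<in> pre_units H \<or> reducible y \<or> (\<exists>b \<in> ?A. b \<approx> y)"
        and z: "z \<in> carrier H" "z \<in> pre_units H \<or> reducible z \<or> (\<exists>b \<in> ?A. b \<approx> z)"
      consider "y \<in> pre_units H" "z \<in> pre_units H"
        | "y \<in> pre_nonunits H" "z \<in> pre_nonunits H"
        | "y \<in> pre_units H" "z \<in> pre_nonunits H"
        | "y \<in> pre_nonunits H" "z \<in> pre_units H"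
        using y(1) z(1) by (auto simp: pre_nonunits_def)
      then show "y \<otimes> z \<in> pre_units H \<or> reducible (y \<otimes> z) \<or> (\<exists>b \<in> ?A. b \<approx> y \<otimes> z)"
      proof cases
        case 1
        then show ?thesis by (simp add: unit_mult)
      next
        case 2
        then show ?thesis by (auto simp: reducible_def)
      next
        case 3
        \<comment> \<open>The unit is absorbed into the adjacent factor, which remains a
          non-unit.\<close>
        have "reducible (y \<otimes> z)" if "reducible z"
          using that y(1) unfolding reducible_def
          by (metis m_assoc nonunit_mult_left pre_nonunits_closed)
        moreover have "b \<approx> y \<otimes> z" if "b \<in> ?A" "b \<approx> z" for b
          using that pre_equiv_trans[of b z "y \<otimes> z"] 3 y z
            pre_equiv_sym[OF mult_unit_left_equiv[of y z]]
          by (simp add: pre_nonunits_closed)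
        ultimately show ?thesis
          using z 3 by (auto simp: pre_nonunits_def)
      next
        case 4
        have "reducible (y \<otimes> z)" if "reducible y"
          using that z(1) unfolding reducible_def
          by (metis m_assoc nonunit_mult_right pre_nonunits_closed)
        moreover have "b \<approx> y \<otimes> z" if "b \<in> ?A" "b \<approx> y" for b
          using that pre_equiv_trans[of b y "y \<otimes> z"] 4 y z
            pre_equiv_sym[OF mult_unit_right_equiv[of z y]]
          by (simp add: pre_nonunits_closed)
        ultimately show ?thesis
          using y 4 by (auto simp: pre_nonunits_def)
      qed
    next
      fix u b v assume b: "u \<in> pre_units H" "b \<in> B" "b \<in> carrier H" "v \<in> pre_units H"
      then show "u \<otimes> b \<otimes> v \<in> pre_units H \<or> reducible (u \<otimes> b \<otimes> v) \<or> (\<exists>c \<in> ?A. c \<approx> u \<otimes> b \<otimes> v)"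
        using gen_equiv[of u b v] unit_mult unfolding pre_nonunits_def by blast
    qed
    then show ?thesis
      using that(2) by (auto simp: pre_atoms_def reducible_def pre_nonunits_def)
  qed
  ultimately show thesis
    using B(1) by (intro that[of ?A]) auto
qed

section \<open>Existence and finiteness of atomic factorizations\<close>

text \<open>Words representing the letters are concatenated. Each is nonempty because its letter is
  a non-unit, so the length does not drop.\<close>

lemma refine_word:
  assumes "A \<subseteq> pre_nonunits H" "ys \<in> lists (pre_nonunits H)"
    and "\<And>y. y \<in> set ys \<Longrightarrow> \<exists>w \<in> lists A. \<Pi> w \<approx> y"
  shows "\<exists>w \<in> lists A. \<Pi> w \<approx> \<Pi> ys \<and> length ys \<le> length w"
  using assms(2,3)
proof (induction ys rule: list.induct)
  case Nil
  then show ?case by (intro bexI[of _ "[]"]) auto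
next
  case (Cons y ys)
  then obtain v where v: "v \<in> lists A" "\<Pi> v \<approx> \<Pi> ys" "length ys \<le> length v"
    by auto
  obtain w where w: "w \<in> lists A" "\<Pi> w \<approx> y"
    using Cons.prems(2)[of y] by auto
  have y: "y \<in> pre_nonunits H" and ys: "ys \<in> lists (carrier H)"
    using Cons.prems(1) by (auto simp: pre_nonunits_closed)
  have "w \<noteq> []"
  proof
    assume "w = []"
    then have "y \<approx> \<one>"
      using w(2) by (simp add: pre_equiv_sym)
    then show False
      using y by (auto simp: pre_nonunits_def pre_units_iff_equiv)
  qed
  moreover have "v \<in> lists (carrier H)" "w \<in> lists (carrier H)"
    using v(1) w(1) assms(1) by (auto simp: pre_nonunits_closed subset_eq)
  then have "\<Pi> (w @ v) \<approx> \<Pi> (y # ys)"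
    using v(2) w(2) y ys
    by (simp add: pre_nonunits_closed word_prod_append mult_equiv word_prod_closed
        del: foldr_append)
  ultimately show ?case
    using v w by (intro bexI[of _ "w @ v"]) (auto simp: neq_Nil_conv)
qed

lemma atomic_factorizations_nonempty:
  assumes "x \<in> pre_nonunits H" "fgu (germ H x)"
  shows "atomic_factorizations H x \<noteq> {}"
proof -
  obtain A where A: "finite A" "A \<subseteq> pre_nonunits H"
    and rep: "\<And>y. y \<in> carrier (germ H x) \<Longrightarrow> \<exists>w \<in> lists A. \<Pi> w \<approx> y"
    using fgu_germ_representatives[OF assms(2)] by metis
  let ?W = "{w \<in> lists A. \<Pi> w \<approx> x}"
  \<comment> \<open>Arbitrary non-unit letters are allowed, so that \<open>[x]\<close> qualifies
    before any atomic factorization is known.\<close>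
  let ?F = "\<lambda>ys. ys \<in> lists (pre_nonunits H) \<and> \<Pi> ys = x"
  have fin: "finite ?W"
    using finite_words_equiv_prod[OF A] assms(1) by (simp add: pre_nonunits_closed)
  have bound: "length ys < Suc (Max (length ` ?W))" if ys: "?F ys" for ys
  proof -
    have "y \<in> carrier (germ H x)" if "y \<in> set ys" for y
      using letter_in_divisors[OF pre_nonunits_lists that] ys divisors_subset_germ by blast
    then obtain w where w: "w \<in> lists A" "\<Pi> w \<approx> \<Pi> ys" "length ys \<le> length w"
      using refine_word[OF A(2), of ys] rep ys by blast
    then have "length w \<le> Max (length ` ?W)"
      using fin ys by (intro Max_ge) auto
    then show ?thesis
      using w(3) by linarith
  qed
  have "?F [x]"
    using assms(1) by (simp add: pre_nonunits_closed)
  then obtain ys where ys: "?F ys" and max: "\<And>zs. ?F zs \<Longrightarrow> length zs \<le> length ys"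
    using ex_has_greatest_nat[of ?F "[x]" length "Suc (Max (length ` ?W))"] bound by blast
  have "a \<in> pre_atoms H" if a: "a \<in> set ys" for a
  proof (rule ccontr)
    assume "a \<notin> pre_atoms H"
    then obtain p q where pq: "p \<in> pre_nonunits H" "q \<in> pre_nonunits H" "a = p \<otimes> q"
      using a ys by (auto simp: pre_atoms_def)
    obtain u v where uv: "ys = u @ a # v"
      using a by (auto dest: split_list)
    then have l: "u \<in> lists (pre_nonunits H)" "v \<in> lists (pre_nonunits H)"
      using ys by auto
    \<comment> \<open>Splitting \<open>a\<close> keeps the product and adds one letter, against
      maximality.\<close>
    then have "\<Pi> (u @ p # q # v) = \<Pi> ys"
      using pq uv word_prod_append[of u "p # q # v"] word_prod_append[of u "a # v"]
      by (simp add: m_assoc pre_nonunits_lists pre_nonunits_closed word_prod_closed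
          del: foldr_append in_lists_conv_set)
    then have "?F (u @ p # q # v)"
      using ys l pq by simp
    then show False
      using max[of "u @ p # q # v"] uv by simp
  qed
  then show ?thesis
    using ys by (auto simp: atomic_factorizations_def)
qed

text \<open>Each letter is replaced by an equivalent element of \<open>A\<close>. Two factorizations
  with the same resulting word are both equivalent to it, and only finitely many such words
  occur.\<close>

lemma finite_atomic_factorization_classes:
  assumes "x \<in> pre_nonunits H" "fgu (germ H x)"
  shows "finite (atomic_factorizations H x // word_equiv H)"
proof -
  obtain A where A: "finite A" "A \<subseteq> pre_nonunits H"
    and rep: "\<And>a. \<lbrakk>a \<in> carrier (germ H x); a \<in> pre_atoms H\<rbrakk> \<Longrightarrow> \<exists>b \<in> A. b \<approx> a"
    using fgu_germ_representatives[OF assms(2)] by metis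
  \<comment> \<open>The choice is meaningful only for atoms in the germ, which include all letters
    concerned.\<close>
  define r where "r a = (SOME b. b \<in> A \<and> b \<approx> a)" for a
  have r: "r a \<in> A \<and> r a \<approx> a" if "a \<in> carrier (germ H x)" "a \<in> pre_atoms H" for a
    unfolding r_def by (rule someI_ex) (use rep[OF that] in blast)
  have carrier: "as \<in> lists (carrier H)" if "as \<in> atomic_factorizations H x" for as
    using that by (auto simp: atomic_factorizations_def pre_atoms_def pre_nonunits_closed)
  have letters: "r a \<in> A \<and> r a \<approx> a" if "as \<in> atomic_factorizations H x" "a \<in> set as" for as a
    using letter_in_divisors[OF carrier[OF that(1)] that(2)] divisors_subset_germ that
    by (intro r) (auto simp: atomic_factorizations_def)
  have map_r: "list_all2 (pre_equiv H) (map r as) as" "map r as \<in> lists A"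
    if "as \<in> atomic_factorizations H x" for as
    using letters[OF that] by (auto simp: list_all2_conv_all_nth)
  have A_lists: "lists A \<subseteq> lists (carrier H)"
    using A(2) by (intro lists_mono) (auto simp: pre_nonunits_closed)
  show ?thesis
  proof (rule finite_quotient_if_factors)
    \<comment> \<open>After the replacement the product is only equivalent to \<open>x\<close>,
      which is why the finiteness result is about products up to equivalence.\<close>
    have "map r ` atomic_factorizations H x \<subseteq> {w \<in> lists A. \<Pi> w \<approx> x}"
    proof (rule image_subsetI)
      fix as assume as: "as \<in> atomic_factorizations H x"
      have "\<Pi> (map r as) \<approx> \<Pi> as"
        using word_prod_equiv map_r[OF as] A_lists carrier[OF as] by blast
      then show "map r as \<in> {w \<in> lists A. \<Pi> w \<approx> x}"
        using as map_r(2)[OF as] by (simp add: atomic_factorizations_def)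
    qed
    then show "finite (map r ` atomic_factorizations H x)"
      using finite_words_equiv_prod[OF A, of x] assms(1) finite_subset
      by (auto simp: pre_nonunits_closed)
  next
    have equiv_map: "(as, map r as) \<in> word_equiv H" if as: "as \<in> atomic_factorizations H x" for as
    proof -
      have "list_all2 (pre_equiv H) as (map r as)"
        using map_r(1)[OF as] by (simp add: list_all2_conv_all_nth pre_equiv_sym)
      then show ?thesis
        using map_r[OF as] carrier[OF as] A_lists
        by (auto simp: word_equiv_def simp del: in_lists_conv_set intro: word_le_if_letters_equiv)
    qed
    fix as bs
    assume "as \<in> atomic_factorizations H x" "bs \<in> atomic_factorizations H x" "map r as = map r bs"
    then show "word_equiv H `` {as} = word_equiv H `` {bs}"
      using equiv_map equiv_class_eq[OF equiv_word_equiv] by metis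
  qed
qed

end

theorem corollary4p13:
  fixes H :: "('a, 'b) premonoid_scheme"
  assumes "strongly_positive_monoid H"
    and "weakly_lfgu H"
  shows "FF_atomic H"
proof -
  interpret strongly_positive_monoid H
    by (rule assms(1))
  show ?thesis
    using assms(2) atomic_factorizations_nonempty finite_atomic_factorization_classes
    by (simp add: FF_atomic_def weakly_lfgu_def)
qed

end
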